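(* Let $\underline{\mathsf{Cyl}}=(\mathsf{Cyl},i_0,i_1,p,v,\mathsf S,r_0,r_1,s,\Gamma_{lr},\Gamma_{ur})$ be a cylinder in a formal category $\mathcal A$ equipped with a contraction structure $p$, an involution structure $v$, a subdivision structure $(\mathsf S,r_0,r_1,s)$ compatible with $p$, a lower right connection structure $\Gamma_{lr}$, and an upper right connection structure $\Gamma_{ur}$. Suppose that $\Gamma_{lr}$ and $\Gamma_{ur}$ are compatible with the subdivision structure $(\mathsf S,r_0,r_1,s)$, and that $\mathsf{Cyl}$ preserves mapping cylinders with respect to $\underline{\mathsf{Cyl}}$. Let $f$ be an arrow of $\mathcal A$ which is a normally cloven fibration with respect to $\underline{\mathsf{Cyl}}$, and let $j$ be an arrow of $\mathcal A$ which is a cofibration with respect to $\underline{\mathsf{Cyl}}$. Then $f$ has the covering homotopy extension property with respect to $j$ and $\underline{\mathsf{Cyl}}$.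
   Context: Formal categories. Let $\mathcal C$ be a strict 2-category with a final object $1$. For an object $\mathcal A$ of $\mathcal C$, an object of $\mathcal A$ is a 1-arrow $1\to\mathcal A$ and an arrow of $\mathcal A$ is a 2-arrow between such; composition, commutative diagrams, pushouts and pullbacks in $\mathcal A$ are those of the category $\mathrm{Hom}_{\mathcal C}(1,\mathcal A)$. For 1-arrows $F,F_0,F_1:\mathcal A\to\mathcal A$, a 2-arrow $\eta:F_0\to F_1$, an object $a$ and an arrow $f$ of $\mathcal A$: $F(a)=F\circ a$, $F(f)$ is the whiskering of $F$ and $f$, $\eta(a):F_0(a)\to F_1(a)$ is the whiskering of $\eta$ and $a$; $F\cdot\eta$, $\eta\cdot F$ are whiskerings. Standing assumption: for all objects $\mathcal A_0,\mathcal A_1$ of $\mathcal C$ and objects $a$ of $\mathcal A_0$, evaluation at $a$ sends pushout (resp. pullback) squares of $\mathrm{Hom}_{\mathcal C}(\mathcal A_0,\mathcal A_1)$ to pushout (resp. pullback) squares of $\mathcal A_1$. (For $\mathcal C$ the 2-category of categories these are ordinary categories, functors and natural transformations.) $\mathcal A$ is a fixed object of $\mathcal C$. A cylinder in $\mathcal A$ is a 1-arrow $\mathsf{Cyl}:\mathcal A\to\mathcal A$ with 2-arrows $i_0,i_1:\mathrm{id}_{\mathcal A}\to\mathsf{Cyl}$. Contraction: $p:\mathsf{Cyl}\to\mathrm{id}_{\mathcal A}$ with $pi_0=pi_1=\mathrm{id}$. Involution: $v:\mathsf{Cyl}\to\mathsf{Cyl}$ with $vi_0=i_1$, $vi_1=i_0$.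 Subdivision: a 1-arrow $\mathsf S:\mathcal A\to\mathcal A$, 2-arrows $r_0,r_1:\mathsf{Cyl}\to\mathsf S$ with $r_0i_0=r_1i_1$ a pushout square of $i_0$ and $i_1$ in $\mathrm{Hom}_{\mathcal C}(\mathcal A,\mathcal A)$, and $s:\mathsf{Cyl}\to\mathsf S$ with $si_0=r_1i_0$, $si_1=r_0i_1$; compatible with $p$ if $\overline ps=p$, where $\overline p:\mathsf S\to\mathrm{id}_{\mathcal A}$ is the unique 2-arrow with $\overline pr_0=\overline pr_1=p$. Lower right connection: $\Gamma_{lr}:\mathsf{Cyl}^2\to\mathsf{Cyl}$ with $\Gamma_{lr}(i_1\cdot\mathsf{Cyl})=\Gamma_{lr}(\mathsf{Cyl}\cdot i_1)=\mathrm{id}$, $\Gamma_{lr}(i_0\cdot\mathsf{Cyl})=\Gamma_{lr}(\mathsf{Cyl}\cdot i_0)=i_0p$. Upper right connection: $\Gamma_{ur}:\mathsf{Cyl}^2\to\mathsf{Cyl}$ with $\Gamma_{ur}(i_0\cdot\mathsf{Cyl})=\mathrm{id}$, $\Gamma_{ur}(\mathsf{Cyl}\cdot i_1)=v$, $\Gamma_{ur}(\mathsf{Cyl}\cdot i_0)=\Gamma_{ur}(i_1\cdot\mathsf{Cyl})=i_0p$. $\Gamma_{lr},\Gamma_{ur}$ are compatible with $(\mathsf S,r_0,r_1,s)$ if $x(s\cdot\mathsf{Cyl})=p\cdot\mathsf{Cyl}$, where $x:\mathsf S\circ\mathsf{Cyl}\to\mathsf{Cyl}$ is the unique (canonical)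 2-arrow with $x(r_0\cdot\mathsf{Cyl})=\Gamma_{lr}$, $x(r_1\cdot\mathsf{Cyl})=\Gamma_{ur}$. Mapping cylinder of $j:a_0\to a_1$: an object $a_j$ with $d^0_j:\mathsf{Cyl}(a_0)\to a_j$, $d^1_j:a_1\to a_j$ such that $d^0_j\circ i_0(a_0)=d^1_j\circ j$ is a pushout square; $m_j:a_j\to\mathsf{Cyl}(a_1)$ is the unique arrow with $m_j\circ d^0_j=\mathsf{Cyl}(j)$, $m_j\circ d^1_j=i_0(a_1)$. $\mathsf{Cyl}$ preserves mapping cylinders if it carries each such pushout square to a pushout square (with maps $\mathsf{Cyl}(i_0(a_0)),\mathsf{Cyl}(d^0_j),\mathsf{Cyl}(j),\mathsf{Cyl}(d^1_j)$). Covering homotopy extension property: let $j:a_0\to a_1$ be an arrow with a mapping cylinder $(a_j,d^0_j,d^1_j)$. An arrow $f:a_2\to a_3$ has the covering homotopy extension property with respect to $j$ and $\underline{\mathsf{Cyl}}$ if for all $g:a_j\to a_2$, $h:\mathsf{Cyl}(a_1)\to a_3$ with $f\circ g=h\circ m_j$ there is $l:\mathsf{Cyl}(a_1)\to a_2$ with $l\circ m_j=g$ and $f\circ l=h$. (A mapping cylinder of $j$ is part of the data presupposed by this notion.) Cofibration with respect to $\underline{\mathsf{Cyl}}$: $j:a_0\to a_1$ such that for all $f:a_1\to a_2$, $h:\mathsf{Cyl}(a_0)\to a_2$ with $h\circ i_0(a_0)=f\circ j$ there is $k:\mathsf{Cyl}(a_1)\to a_2$ with $k\circ\mathsf{Cyl}(j)=h$,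 $k\circ i_0(a_1)=f$. Normally cloven fibration with respect to $\underline{\mathsf{Cyl}}$: $f:a_1\to a_2$ for which one can choose, for every object $a_0$ and all $g:a_0\to a_1$, $h:\mathsf{Cyl}(a_0)\to a_2$ with $h\circ i_0(a_0)=f\circ g$, an arrow $l_{a_0}(g,h):\mathsf{Cyl}(a_0)\to a_1$ with $l_{a_0}(g,h)\circ i_0(a_0)=g$, $f\circ l_{a_0}(g,h)=h$, such that (i) $l_{a_0}(g,f\circ g\circ p(a_0))=g\circ p(a_0)$, and (ii) $l_{a_{-1}}(g\circ u,h\circ\mathsf{Cyl}(u))=l_{a_0}(g,h)\circ\mathsf{Cyl}(u)$ for all $u:a_{-1}\to a_0$. *)

theory Defs
  imports Main
begin

section \<open>Strict 2-categories\<close>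

text \<open>\<open>comp1\<close> composes 1-arrows, \<open>vcomp\<close> and \<open>hcomp\<close> compose 2-arrows vertically and
  horizontally; all three are written in the order of composition of functions, so that
  \<open>G \<odot> F\<close> is ``\<open>F\<close>, then \<open>G\<close>''. The operations are only meaningful on composable arrows.\<close>

record ('o, 'm, 'c) two_category =
  Obj   :: "'o set"
  Arr1  :: "'m set"
  dom1  :: "'m \<Rightarrow> 'o"
  cod1  :: "'m \<Rightarrow> 'o"
  id1   :: "'o \<Rightarrow> 'm"
  comp1 :: "'m \<Rightarrow> 'm \<Rightarrow> 'm" (infixl "\<odot>\<index>" 75)
  Arr2  :: "'c set"
  dom2  :: "'c \<Rightarrow> 'm"
  cod2  :: "'c \<Rightarrow> 'm"
  id2   :: "'m \<Rightarrow> 'c"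
  vcomp :: "'c \<Rightarrow> 'c \<Rightarrow> 'c" (infixl "\<cdot>\<index>" 65)
  hcomp :: "'c \<Rightarrow> 'c \<Rightarrow> 'c" (infixl "\<star>\<index>" 70)

context
  fixes C :: "('o, 'm, 'c) two_category" (structure)
begin

definition hom1 :: "'o \<Rightarrow> 'o \<Rightarrow> 'm set" where
  "hom1 A B = {F \<in> Arr1 C. dom1 C F = A \<and> cod1 C F = B}"

definition hom2 :: "'m \<Rightarrow> 'm \<Rightarrow> 'c set" where
  "hom2 F G = {\<alpha> \<in> Arr2 C. dom2 C \<alpha> = F \<and> cod2 C \<alpha> = G}"

text \<open>The arrows of the category \<open>Hom(A, B)\<close>, whose set of objects is \<open>hom1 A B\<close>.\<close>

definition hom_arr :: "'o \<Rightarrow> 'o \<Rightarrow> 'c set" where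
  "hom_arr A B = {\<alpha> \<in> Arr2 C. dom2 C \<alpha> \<in> hom1 A B \<and> cod2 C \<alpha> \<in> hom1 A B}"

end

definition lwhisker :: "('o, 'm, 'c) two_category \<Rightarrow> 'm \<Rightarrow> 'c \<Rightarrow> 'c" (infixr "\<triangleright>\<index>" 80)
  where "F \<triangleright>\<^bsub>C\<^esub> \<alpha> = id2 C F \<star>\<^bsub>C\<^esub> \<alpha>"

definition rwhisker :: "('o, 'm, 'c) two_category \<Rightarrow> 'c \<Rightarrow> 'm \<Rightarrow> 'c" (infixl "\<triangleleft>\<index>" 80)
  where "\<alpha> \<triangleleft>\<^bsub>C\<^esub> F = \<alpha> \<star>\<^bsub>C\<^esub> id2 C F"

locale strict_two_category =
  fixes C :: "('o, 'm, 'c) two_category" (structure)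
  assumes dom1_obj: "F \<in> Arr1 C \<Longrightarrow> dom1 C F \<in> Obj C"
    and cod1_obj: "F \<in> Arr1 C \<Longrightarrow> cod1 C F \<in> Obj C"
    and id1_hom: "A \<in> Obj C \<Longrightarrow> id1 C A \<in> hom1 C A A"
    and comp1_hom: "\<lbrakk>F \<in> hom1 C A B; G \<in> hom1 C B D\<rbrakk> \<Longrightarrow> G \<odot> F \<in> hom1 C A D"
    and comp1_id_left: "F \<in> hom1 C A B \<Longrightarrow> id1 C B \<odot> F = F"
    and comp1_id_right: "F \<in> hom1 C A B \<Longrightarrow> F \<odot> id1 C A = F"
    and comp1_assoc: "\<lbrakk>F \<in> hom1 C A B; G \<in> hom1 C B D; H \<in> hom1 C D E\<rbrakk>
          \<Longrightarrow> (H \<odot> G) \<odot> F = H \<odot> (G \<odot> F)"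
    and dom2_arr: "\<alpha> \<in> Arr2 C \<Longrightarrow> dom2 C \<alpha> \<in> Arr1 C"
    and cod2_arr: "\<alpha> \<in> Arr2 C \<Longrightarrow> cod2 C \<alpha> \<in> Arr1 C"
    and parallel_dom: "\<alpha> \<in> Arr2 C \<Longrightarrow> dom1 C (dom2 C \<alpha>) = dom1 C (cod2 C \<alpha>)"
    and parallel_cod: "\<alpha> \<in> Arr2 C \<Longrightarrow> cod1 C (dom2 C \<alpha>) = cod1 C (cod2 C \<alpha>)"
    and id2_hom: "F \<in> Arr1 C \<Longrightarrow> id2 C F \<in> hom2 C F F"
    and vcomp_hom: "\<lbrakk>\<alpha> \<in> hom2 C F G; \<beta> \<in> hom2 C G H\<rbrakk> \<Longrightarrow> \<beta> \<cdot> \<alpha> \<in> hom2 C F H"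
    and vcomp_id_left: "\<alpha> \<in> hom2 C F G \<Longrightarrow> id2 C G \<cdot> \<alpha> = \<alpha>"
    and vcomp_id_right: "\<alpha> \<in> hom2 C F G \<Longrightarrow> \<alpha> \<cdot> id2 C F = \<alpha>"
    and vcomp_assoc: "\<lbrakk>\<alpha> \<in> hom2 C F G; \<beta> \<in> hom2 C G H; \<gamma> \<in> hom2 C H K\<rbrakk>
          \<Longrightarrow> (\<gamma> \<cdot> \<beta>) \<cdot> \<alpha> = \<gamma> \<cdot> (\<beta> \<cdot> \<alpha>)"
    and hcomp_hom: "\<lbrakk>F \<in> hom1 C A B; G \<in> hom1 C B D; \<alpha> \<in> hom2 C F F'; \<beta> \<in> hom2 C G G'\<rbrakk>
          \<Longrightarrow> \<beta> \<star> \<alpha> \<in> hom2 C (G \<odot> F) (G' \<odot> F')"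
    and hcomp_id2: "\<lbrakk>F \<in> hom1 C A B; G \<in> hom1 C B D\<rbrakk>
          \<Longrightarrow> id2 C G \<star> id2 C F = id2 C (G \<odot> F)"
    and interchange: "\<lbrakk>F \<in> hom1 C A B; G \<in> hom1 C B D;
            \<alpha> \<in> hom2 C F F'; \<alpha>' \<in> hom2 C F' F''; \<beta> \<in> hom2 C G G'; \<beta>' \<in> hom2 C G' G''\<rbrakk>
          \<Longrightarrow> (\<beta>' \<cdot> \<beta>) \<star> (\<alpha>' \<cdot> \<alpha>) = (\<beta>' \<star> \<alpha>') \<cdot> (\<beta> \<star> \<alpha>)"
    and hcomp_id_left: "\<alpha> \<in> hom_arr C A B \<Longrightarrow> id2 C (id1 C B) \<star> \<alpha> = \<alpha>"
    and hcomp_id_right: "\<alpha> \<in> hom_arr C A B \<Longrightarrow> \<alpha> \<star> id2 C (id1 C A) = \<alpha>"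
    and hcomp_assoc: "\<lbrakk>\<alpha> \<in> hom_arr C A B; \<beta> \<in> hom_arr C B D; \<gamma> \<in> hom_arr C D E\<rbrakk>
          \<Longrightarrow> (\<gamma> \<star> \<beta>) \<star> \<alpha> = \<gamma> \<star> (\<beta> \<star> \<alpha>)"

context
  fixes C :: "('o, 'm, 'c) two_category" (structure)
begin

text \<open>Final in the 2-categorical sense: each \<open>Hom(A, T)\<close> is a terminal category.\<close>

definition final_object :: "'o \<Rightarrow> bool" where
  "final_object T \<longleftrightarrow> T \<in> Obj C \<and>
     (\<forall>A\<in>Obj C. (\<exists>!F. F \<in> hom1 C A T) \<and>
        (\<forall>F\<in>hom1 C A T. \<forall>G\<in>hom1 C A T. \<exists>!\<alpha>. \<alpha> \<in> hom2 C F G))"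

text \<open>The square \<open>u \<cdot> f = v \<cdot> g\<close> is a pushout of \<open>f\<close> and \<open>g\<close> in \<open>Hom(A, B)\<close>.\<close>

definition is_pushout :: "'o \<Rightarrow> 'o \<Rightarrow> 'c \<Rightarrow> 'c \<Rightarrow> 'c \<Rightarrow> 'c \<Rightarrow> bool" where
  "is_pushout A B f g u v \<longleftrightarrow>
     f \<in> hom_arr C A B \<and> g \<in> hom_arr C A B \<and> u \<in> hom_arr C A B \<and> v \<in> hom_arr C A B \<and>
     dom2 C f = dom2 C g \<and> dom2 C u = cod2 C f \<and> dom2 C v = cod2 C g \<and> cod2 C u = cod2 C v \<and>
     u \<cdot> f = v \<cdot> g \<and>
     (\<forall>T\<in>hom1 C A B. \<forall>x\<in>hom2 C (cod2 C f) T. \<forall>y\<in>hom2 C (cod2 C g) T.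
        x \<cdot> f = y \<cdot> g \<longrightarrow> (\<exists>!z. z \<in> hom2 C (cod2 C u) T \<and> z \<cdot> u = x \<and> z \<cdot> v = y))"

text \<open>The square \<open>f \<cdot> u = g \<cdot> v\<close> is a pullback of \<open>f\<close> and \<open>g\<close> in \<open>Hom(A, B)\<close>.\<close>

definition is_pullback :: "'o \<Rightarrow> 'o \<Rightarrow> 'c \<Rightarrow> 'c \<Rightarrow> 'c \<Rightarrow> 'c \<Rightarrow> bool" where
  "is_pullback A B f g u v \<longleftrightarrow>
     f \<in> hom_arr C A B \<and> g \<in> hom_arr C A B \<and> u \<in> hom_arr C A B \<and> v \<in> hom_arr C A B \<and>
     cod2 C f = cod2 C g \<and> cod2 C u = dom2 C f \<and> cod2 C v = dom2 C g \<and> dom2 C u = dom2 C v \<and>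
     f \<cdot> u = g \<cdot> v \<and>
     (\<forall>T\<in>hom1 C A B. \<forall>x\<in>hom2 C T (dom2 C f). \<forall>y\<in>hom2 C T (dom2 C g).
        f \<cdot> x = g \<cdot> y \<longrightarrow> (\<exists>!z. z \<in> hom2 C T (dom2 C u) \<and> u \<cdot> z = x \<and> v \<cdot> z = y))"

end

text \<open>The setting for formal categories: objects of \<open>A \<in> Obj C\<close> are the elements of
  \<open>hom1 C one A\<close>, and arrows of \<open>A\<close> from \<open>a\<close> to \<open>b\<close> are the elements of \<open>hom2 C a b\<close>, composed by
  \<open>\<cdot>\<close>. For a 1-arrow \<open>F\<close>, a 2-arrow \<open>\<eta>\<close>, an object \<open>a\<close> and an arrow \<open>f\<close> of \<open>A\<close>, one has
  \<open>F(a) = F \<odot> a\<close>, \<open>F(f) = F \<triangleright> f\<close> and \<open>\<eta>(a) = \<eta> \<triangleleft> a\<close>.\<close>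

locale formal_setting = strict_two_category C
  for C :: "('o, 'm, 'c) two_category" (structure) +
  fixes one :: 'o
  assumes final_one: "final_object C one"
    and eval_pushout: "\<lbrakk>A0 \<in> Obj C; A1 \<in> Obj C; a \<in> hom1 C one A0; is_pushout C A0 A1 f g u w\<rbrakk>
          \<Longrightarrow> is_pushout C one A1 (f \<triangleleft> a) (g \<triangleleft> a) (u \<triangleleft> a) (w \<triangleleft> a)"
    and eval_pullback: "\<lbrakk>A0 \<in> Obj C; A1 \<in> Obj C; a \<in> hom1 C one A0; is_pullback C A0 A1 f g u w\<rbrakk>
          \<Longrightarrow> is_pullback C one A1 (f \<triangleleft> a) (g \<triangleleft> a) (u \<triangleleft> a) (w \<triangleleft> a)"

section \<open>Cylinders and their structures\<close>

context
  fixes C :: "('o, 'm, 'c) two_category" (structure)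
begin

definition cylinder :: "'o \<Rightarrow> 'm \<Rightarrow> 'c \<Rightarrow> 'c \<Rightarrow> bool" where
  "cylinder A Cyl i0 i1 \<longleftrightarrow>
     Cyl \<in> hom1 C A A \<and> i0 \<in> hom2 C (id1 C A) Cyl \<and> i1 \<in> hom2 C (id1 C A) Cyl"

definition contraction :: "'o \<Rightarrow> 'm \<Rightarrow> 'c \<Rightarrow> 'c \<Rightarrow> 'c \<Rightarrow> bool" where
  "contraction A Cyl i0 i1 p \<longleftrightarrow>
     p \<in> hom2 C Cyl (id1 C A) \<and> p \<cdot> i0 = id2 C (id1 C A) \<and> p \<cdot> i1 = id2 C (id1 C A)"

definition involution :: "'m \<Rightarrow> 'c \<Rightarrow> 'c \<Rightarrow> 'c \<Rightarrow> bool" where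
  "involution Cyl i0 i1 v \<longleftrightarrow> v \<in> hom2 C Cyl Cyl \<and> v \<cdot> i0 = i1 \<and> v \<cdot> i1 = i0"

definition subdivision ::
  "'o \<Rightarrow> 'm \<Rightarrow> 'c \<Rightarrow> 'c \<Rightarrow> 'm \<Rightarrow> 'c \<Rightarrow> 'c \<Rightarrow> 'c \<Rightarrow> bool" where
  "subdivision A Cyl i0 i1 S r0 r1 s \<longleftrightarrow>
     S \<in> hom1 C A A \<and> r0 \<in> hom2 C Cyl S \<and> r1 \<in> hom2 C Cyl S \<and>
     is_pushout C A A i0 i1 r0 r1 \<and>
     s \<in> hom2 C Cyl S \<and> s \<cdot> i0 = r1 \<cdot> i0 \<and> s \<cdot> i1 = r0 \<cdot> i1"

text \<open>The 2-arrow \<open>p\<close>-bar from \<open>S\<close> to the identity; it exists uniquely by the pushout property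
  whenever \<open>p\<close> is a contraction.\<close>

definition subdivision_contraction :: "'o \<Rightarrow> 'c \<Rightarrow> 'm \<Rightarrow> 'c \<Rightarrow> 'c \<Rightarrow> 'c" where
  "subdivision_contraction A p S r0 r1 =
     (THE q. q \<in> hom2 C S (id1 C A) \<and> q \<cdot> r0 = p \<and> q \<cdot> r1 = p)"

definition subdivision_compatible_contraction ::
  "'o \<Rightarrow> 'c \<Rightarrow> 'm \<Rightarrow> 'c \<Rightarrow> 'c \<Rightarrow> 'c \<Rightarrow> bool" where
  "subdivision_compatible_contraction A p S r0 r1 s \<longleftrightarrow>
     subdivision_contraction A p S r0 r1 \<cdot> s = p"

definition lower_right_connection :: "'m \<Rightarrow> 'c \<Rightarrow> 'c \<Rightarrow> 'c \<Rightarrow> 'c \<Rightarrow> bool" where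
  "lower_right_connection Cyl i0 i1 p \<Gamma> \<longleftrightarrow>
     \<Gamma> \<in> hom2 C (Cyl \<odot> Cyl) Cyl \<and>
     \<Gamma> \<cdot> (i1 \<triangleleft> Cyl) = id2 C Cyl \<and> \<Gamma> \<cdot> (Cyl \<triangleright> i1) = id2 C Cyl \<and>
     \<Gamma> \<cdot> (i0 \<triangleleft> Cyl) = i0 \<cdot> p \<and> \<Gamma> \<cdot> (Cyl \<triangleright> i0) = i0 \<cdot> p"

definition upper_right_connection :: "'m \<Rightarrow> 'c \<Rightarrow> 'c \<Rightarrow> 'c \<Rightarrow> 'c \<Rightarrow> 'c \<Rightarrow> bool" where
  "upper_right_connection Cyl i0 i1 p v \<Gamma> \<longleftrightarrow>
     \<Gamma> \<in> hom2 C (Cyl \<odot> Cyl) Cyl \<and>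
     \<Gamma> \<cdot> (i0 \<triangleleft> Cyl) = id2 C Cyl \<and> \<Gamma> \<cdot> (Cyl \<triangleright> i1) = v \<and>
     \<Gamma> \<cdot> (Cyl \<triangleright> i0) = i0 \<cdot> p \<and> \<Gamma> \<cdot> (i1 \<triangleleft> Cyl) = i0 \<cdot> p"

text \<open>In a general 2-category, precomposition with \<open>Cyl\<close> need not preserve the pushout \<open>S\<close>, so the
  unique existence of the canonical \<open>x\<close> is stated explicitly as part of compatibility.\<close>

definition connections_compatible_subdivision ::
  "'m \<Rightarrow> 'c \<Rightarrow> 'm \<Rightarrow> 'c \<Rightarrow> 'c \<Rightarrow> 'c \<Rightarrow> 'c \<Rightarrow> 'c \<Rightarrow> bool" where
  "connections_compatible_subdivision Cyl p S r0 r1 s \<Gamma>lr \<Gamma>ur \<longleftrightarrow>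
     (let canonical = (\<lambda>x. x \<in> hom2 C (S \<odot> Cyl) Cyl \<and>
                           x \<cdot> (r0 \<triangleleft> Cyl) = \<Gamma>lr \<and> x \<cdot> (r1 \<triangleleft> Cyl) = \<Gamma>ur)
      in \<exists>x. canonical x \<and> (\<forall>y. canonical y \<longrightarrow> y = x) \<and> x \<cdot> (s \<triangleleft> Cyl) = p \<triangleleft> Cyl)"

section \<open>Mapping cylinders, cofibrations and fibrations\<close>

definition mapping_cylinder ::
  "'o \<Rightarrow> 'o \<Rightarrow> 'm \<Rightarrow> 'c \<Rightarrow> 'c \<Rightarrow> 'm \<Rightarrow> 'c \<Rightarrow> 'c \<Rightarrow> bool" where
  "mapping_cylinder one A Cyl i0 j aj d0 d1 \<longleftrightarrow>
     aj \<in> hom1 C one A \<and>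
     d0 \<in> hom2 C (Cyl \<odot> dom2 C j) aj \<and> d1 \<in> hom2 C (cod2 C j) aj \<and>
     is_pushout C one A (i0 \<triangleleft> dom2 C j) j d0 d1"

text \<open>The canonical arrow \<open>m\<^sub>j\<close>, which exists uniquely for every mapping cylinder.\<close>

definition mapping_cylinder_map :: "'m \<Rightarrow> 'c \<Rightarrow> 'c \<Rightarrow> 'm \<Rightarrow> 'c \<Rightarrow> 'c \<Rightarrow> 'c" where
  "mapping_cylinder_map Cyl i0 j aj d0 d1 =
     (THE m. m \<in> hom2 C aj (Cyl \<odot> cod2 C j) \<and>
        m \<cdot> d0 = Cyl \<triangleright> j \<and> m \<cdot> d1 = i0 \<triangleleft> cod2 C j)"

definition preserves_mapping_cylinders :: "'o \<Rightarrow> 'o \<Rightarrow> 'm \<Rightarrow> 'c \<Rightarrow> bool" where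
  "preserves_mapping_cylinders one A Cyl i0 \<longleftrightarrow>
     (\<forall>j\<in>hom_arr C one A. \<forall>aj d0 d1. mapping_cylinder one A Cyl i0 j aj d0 d1 \<longrightarrow>
        is_pushout C one A (Cyl \<triangleright> (i0 \<triangleleft> dom2 C j)) (Cyl \<triangleright> j) (Cyl \<triangleright> d0) (Cyl \<triangleright> d1))"

definition covering_homotopy_extension_property ::
  "'m \<Rightarrow> 'c \<Rightarrow> 'c \<Rightarrow> 'm \<Rightarrow> 'c \<Rightarrow> 'c \<Rightarrow> 'c \<Rightarrow> bool" where
  "covering_homotopy_extension_property Cyl i0 j aj d0 d1 f \<longleftrightarrow>
     (let a1 = cod2 C j; a2 = dom2 C f; a3 = cod2 C f;
          m = mapping_cylinder_map Cyl i0 j aj d0 d1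
      in \<forall>g\<in>hom2 C aj a2. \<forall>h\<in>hom2 C (Cyl \<odot> a1) a3. f \<cdot> g = h \<cdot> m \<longrightarrow>
           (\<exists>l\<in>hom2 C (Cyl \<odot> a1) a2. l \<cdot> m = g \<and> f \<cdot> l = h))"

definition cofibration :: "'o \<Rightarrow> 'o \<Rightarrow> 'm \<Rightarrow> 'c \<Rightarrow> 'c \<Rightarrow> bool" where
  "cofibration one A Cyl i0 j \<longleftrightarrow>
     (let a0 = dom2 C j; a1 = cod2 C j
      in \<forall>a2\<in>hom1 C one A. \<forall>f\<in>hom2 C a1 a2. \<forall>h\<in>hom2 C (Cyl \<odot> a0) a2.
           h \<cdot> (i0 \<triangleleft> a0) = f \<cdot> j \<longrightarrow>
           (\<exists>k\<in>hom2 C (Cyl \<odot> a1) a2. k \<cdot> (Cyl \<triangleright> j) = h \<and> k \<cdot> (i0 \<triangleleft> a1) = f))"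

text \<open>\<open>l a0 g h\<close> is the chosen lift; the equation \<open>h \<cdot> (i0 \<triangleleft> a0) = f \<cdot> g\<close> that it requires holds
  automatically for the pairs at which \<open>l\<close> is evaluated in conditions (i) and (ii).\<close>

definition normally_cloven_fibration :: "'o \<Rightarrow> 'o \<Rightarrow> 'm \<Rightarrow> 'c \<Rightarrow> 'c \<Rightarrow> 'c \<Rightarrow> bool" where
  "normally_cloven_fibration one A Cyl i0 p f \<longleftrightarrow>
     (let a1 = dom2 C f; a2 = cod2 C f
      in \<exists>l :: 'm \<Rightarrow> 'c \<Rightarrow> 'c \<Rightarrow> 'c.
        (\<forall>a0\<in>hom1 C one A. \<forall>g\<in>hom2 C a0 a1. \<forall>h\<in>hom2 C (Cyl \<odot> a0) a2.
           h \<cdot> (i0 \<triangleleft> a0) = f \<cdot> g \<longrightarrow>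
             l a0 g h \<in> hom2 C (Cyl \<odot> a0) a1 \<and>
             l a0 g h \<cdot> (i0 \<triangleleft> a0) = g \<and> f \<cdot> l a0 g h = h) \<and>
        (\<forall>a0\<in>hom1 C one A. \<forall>g\<in>hom2 C a0 a1.
           l a0 g (f \<cdot> g \<cdot> (p \<triangleleft> a0)) = g \<cdot> (p \<triangleleft> a0)) \<and>
        (\<forall>a0\<in>hom1 C one A. \<forall>g\<in>hom2 C a0 a1. \<forall>h\<in>hom2 C (Cyl \<odot> a0) a2.
           h \<cdot> (i0 \<triangleleft> a0) = f \<cdot> g \<longrightarrow>
             (\<forall>b\<in>hom1 C one A. \<forall>u\<in>hom2 C b a0.
                l b (g \<cdot> u) (h \<cdot> (Cyl \<triangleright> u)) = l a0 g h \<cdot> (Cyl \<triangleright> u))))"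

end

end

theory Submission
  imports Defs
begin

text \<open>
  The idea is Strom's: the canonical arrow \<open>m\<close> from the mapping cylinder \<open>a\<^sub>j\<close> of a cofibration
  \<open>j : a\<^sub>0 \<rightarrow> a\<^sub>1\<close> to \<open>Cyl(a\<^sub>1)\<close> is the inclusion of a strong deformation retract, and a normally
  cloven fibration lifts against every such inclusion.

  The cofibration property, applied to the two structure arrows of \<open>a\<^sub>j\<close>, gives a retraction \<open>r\<close>
  with \<open>r m = id\<close>. In topology, a homotopy from \<open>m r\<close> to the identity of \<open>a\<^sub>1 \<times> I\<close> would move
  the two coordinates of \<open>m r(x, t)\<close> separately. A formal cylinder has no coordinates, so
  instead everything is contracted to the end \<open>i\<^sub>0\<close> and expanded again: \<open>m r \<Gamma>\<^sub>u\<^sub>r\<close> is a homotopy from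
  \<open>m r\<close> to \<open>m r i\<^sub>0 p = i\<^sub>0 p\<close>, and \<open>\<Gamma>\<^sub>l\<^sub>r\<close> is a homotopy from \<open>i\<^sub>0 p\<close> to the identity. The subdivision
  composes them to a homotopy \<open>H\<close> from \<open>m r\<close> to \<open>id\<close>. Since \<open>m r\<close> is the identity on \<open>a\<^sub>j\<close>, over
  \<open>Cyl(a\<^sub>0)\<close> the homotopy \<open>H\<close> becomes a homotopy followed by its reverse, constant by the compatibility
  of the connections with the subdivision, and over \<open>a\<^sub>1\<close> a composite of two constant homotopies,
  constant by the compatibility of \<open>p\<close> with the subdivision. As \<open>Cyl(a\<^sub>j)\<close> is again a pushout, \<open>H\<close> is
  constant along \<open>m\<close> (\<open>mapping_cylinder_deformation_retract\<close>).

  Given \<open>g\<close> and \<open>h\<close> with \<open>f g = h m\<close>, the chosen lift of the homotopy \<open>h H\<close> starting at \<open>g r\<close> has the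
  required filler as its end. It restricts to \<open>g\<close> along \<open>m\<close> because the cleavage is
  natural and lifts constant homotopies to constant homotopies
  (\<open>fibration_lifts_against_deformation_retract\<close>).
\<close>

section \<open>Calculating in a strict 2-category\<close>

context strict_two_category
begin

text \<open>The axioms mention sources and targets as variables that occur only in their premises, which
  the simplifier cannot guess. Rephrased through \<open>dom\<close> and \<open>cod\<close>, they become
  rewrite rules whose side conditions are discharged automatically; composites are then
  normalized to right-nested form.\<close>

lemma hom1_iff [simp]: "F \<in> hom1 C X Y \<longleftrightarrow> F \<in> Arr1 C \<and> dom1 C F = X \<and> cod1 C F = Y"
  by (auto simp: hom1_def)

lemma hom2_iff [simp]: "\<alpha> \<in> hom2 C F G \<longleftrightarrow> \<alpha> \<in> Arr2 C \<and> dom2 C \<alpha> = F \<and> cod2 C \<alpha> = G"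
  by (auto simp: hom2_def)

lemma hom_arr_iff: "\<alpha> \<in> hom_arr C X Y \<longleftrightarrow>
    \<alpha> \<in> Arr2 C \<and> dom2 C \<alpha> \<in> hom1 C X Y \<and> cod2 C \<alpha> \<in> hom1 C X Y"
  by (auto simp: hom_arr_def)

lemma id1_typing [simp]:
  assumes "X \<in> Obj C"
  shows "id1 C X \<in> Arr1 C" "dom1 C (id1 C X) = X" "cod1 C (id1 C X) = X"
  using id1_hom[OF assms] by auto

lemma comp1_typing [simp]:
  assumes "F \<in> Arr1 C" "G \<in> Arr1 C" "cod1 C F = dom1 C G"
  shows "G \<odot> F \<in> Arr1 C" "dom1 C (G \<odot> F) = dom1 C F" "cod1 C (G \<odot> F) = cod1 C G"
  using comp1_hom[of F "dom1 C F" "dom1 C G" G "cod1 C G"] assms by auto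

lemma comp1_assoc_simp [simp]:
  assumes "F \<in> Arr1 C" "G \<in> Arr1 C" "H \<in> Arr1 C" "cod1 C F = dom1 C G" "cod1 C G = dom1 C H"
  shows "(H \<odot> G) \<odot> F = H \<odot> (G \<odot> F)"
  using comp1_assoc[of F "dom1 C F" "dom1 C G" G "dom1 C H" H "cod1 C H"] assms by auto

lemma comp1_id_simp [simp]:
  assumes "F \<in> Arr1 C" "cod1 C F = X"
  shows "id1 C X \<odot> F = F"
  using comp1_id_left[of F "dom1 C F" X] assms by auto

lemma id2_typing [simp]:
  assumes "F \<in> Arr1 C"
  shows "id2 C F \<in> Arr2 C" "dom2 C (id2 C F) = F" "cod2 C (id2 C F) = F"
  using id2_hom[OF assms] by auto

lemma vcomp_typing [simp]:
  assumes "\<alpha> \<in> Arr2 C" "\<beta> \<in> Arr2 C" "cod2 C \<alpha> = dom2 C \<beta>"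
  shows "\<beta> \<cdot> \<alpha> \<in> Arr2 C" "dom2 C (\<beta> \<cdot> \<alpha>) = dom2 C \<alpha>" "cod2 C (\<beta> \<cdot> \<alpha>) = cod2 C \<beta>"
  using vcomp_hom[of \<alpha> "dom2 C \<alpha>" "dom2 C \<beta>" \<beta> "cod2 C \<beta>"] assms by auto

lemma vcomp_assoc_simp [simp]:
  assumes "\<alpha> \<in> Arr2 C" "\<beta> \<in> Arr2 C" "\<gamma> \<in> Arr2 C" "cod2 C \<alpha> = dom2 C \<beta>" "cod2 C \<beta> = dom2 C \<gamma>"
  shows "(\<gamma> \<cdot> \<beta>) \<cdot> \<alpha> = \<gamma> \<cdot> (\<beta> \<cdot> \<alpha>)"
  using vcomp_assoc[of \<alpha> "dom2 C \<alpha>" "dom2 C \<beta>" \<beta> "dom2 C \<gamma>" \<gamma> "cod2 C \<gamma>"] assms by auto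

lemma vcomp_id_simp [simp]:
  assumes "\<alpha> \<in> Arr2 C"
  shows "cod2 C \<alpha> = F \<Longrightarrow> id2 C F \<cdot> \<alpha> = \<alpha>" "dom2 C \<alpha> = F \<Longrightarrow> \<alpha> \<cdot> id2 C F = \<alpha>"
  using vcomp_id_left[of \<alpha> "dom2 C \<alpha>" F] vcomp_id_right[of \<alpha> F "cod2 C \<alpha>"] assms by auto

lemma lwhisker_typing [simp]:
  assumes "F \<in> Arr1 C" "\<alpha> \<in> Arr2 C" "cod1 C (dom2 C \<alpha>) = dom1 C F"
  shows "F \<triangleright> \<alpha> \<in> Arr2 C" "dom2 C (F \<triangleright> \<alpha>) = F \<odot> dom2 C \<alpha>" "cod2 C (F \<triangleright> \<alpha>) = F \<odot> cod2 C \<alpha>"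
  using hcomp_hom[of "dom2 C \<alpha>" "dom1 C (dom2 C \<alpha>)" "dom1 C F" F "cod1 C F" \<alpha> "cod2 C \<alpha>" "id2 C F" F]
    assms dom2_arr[of \<alpha>] by (auto simp: lwhisker_def)

lemma rwhisker_typing [simp]:
  assumes "F \<in> Arr1 C" "\<alpha> \<in> Arr2 C" "dom1 C (dom2 C \<alpha>) = cod1 C F"
  shows "\<alpha> \<triangleleft> F \<in> Arr2 C" "dom2 C (\<alpha> \<triangleleft> F) = dom2 C \<alpha> \<odot> F" "cod2 C (\<alpha> \<triangleleft> F) = cod2 C \<alpha> \<odot> F"
  using hcomp_hom[of F "dom1 C F" "cod1 C F" "dom2 C \<alpha>" "cod1 C (dom2 C \<alpha>)" "id2 C F" F \<alpha> "cod2 C \<alpha>"]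
    assms dom2_arr[of \<alpha>] by (auto simp: rwhisker_def)

lemma lwhisker_vcomp:
  assumes "F \<in> Arr1 C" "\<alpha> \<in> Arr2 C" "\<beta> \<in> Arr2 C" "cod2 C \<alpha> = dom2 C \<beta>"
    "cod1 C (dom2 C \<alpha>) = dom1 C F"
  shows "F \<triangleright> (\<beta> \<cdot> \<alpha>) = (F \<triangleright> \<beta>) \<cdot> (F \<triangleright> \<alpha>)"
  using interchange[of "dom2 C \<alpha>" "dom1 C (dom2 C \<alpha>)" "dom1 C F" F "cod1 C F" \<alpha> "cod2 C \<alpha>" \<beta>
      "cod2 C \<beta>" "id2 C F" F "id2 C F" F]
    assms dom2_arr[of \<alpha>] by (auto simp: lwhisker_def)

lemma rwhisker_vcomp:
  assumes "F \<in> Arr1 C" "\<alpha> \<in> Arr2 C" "\<beta> \<in> Arr2 C" "cod2 C \<alpha> = dom2 C \<beta>"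
    "dom1 C (dom2 C \<alpha>) = cod1 C F"
  shows "(\<beta> \<cdot> \<alpha>) \<triangleleft> F = (\<beta> \<triangleleft> F) \<cdot> (\<alpha> \<triangleleft> F)"
  using interchange[of F "dom1 C F" "cod1 C F" "dom2 C \<alpha>" "cod1 C (dom2 C \<alpha>)" "id2 C F" F "id2 C F" F
      \<alpha> "cod2 C \<alpha>" \<beta> "cod2 C \<beta>"]
    assms dom2_arr[of \<alpha>] by (auto simp: rwhisker_def)

lemma rwhisker_id2:
  assumes "F \<in> Arr1 C" "G \<in> Arr1 C" "cod1 C F = dom1 C G"
  shows "id2 C G \<triangleleft> F = id2 C (G \<odot> F)"
  using hcomp_id2[of F "dom1 C F" "dom1 C G" G "cod1 C G"] assms by (auto simp: rwhisker_def)

lemma whisker_naturality: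
  assumes "\<eta> \<in> hom2 C F G" "u \<in> hom2 C a b" "cod1 C a = dom1 C F"
  shows "(\<eta> \<triangleleft> b) \<cdot> (F \<triangleright> u) = (G \<triangleright> u) \<cdot> (\<eta> \<triangleleft> a)"
proof -
  have arr: "F \<in> Arr1 C" "G \<in> Arr1 C" "a \<in> Arr1 C" "b \<in> Arr1 C"
    using assms dom2_arr[of \<eta>] cod2_arr[of \<eta>] dom2_arr[of u] cod2_arr[of u] by auto
  have "(\<eta> \<triangleleft> b) \<cdot> (F \<triangleright> u) = (\<eta> \<cdot> id2 C F) \<star> (id2 C b \<cdot> u)"
    using interchange[of a "dom1 C a" "cod1 C a" F "cod1 C F" u b "id2 C b" b "id2 C F" F \<eta> G] assms arr
    by (auto simp: lwhisker_def rwhisker_def)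
  also have "\<dots> = (id2 C G \<cdot> \<eta>) \<star> (u \<cdot> id2 C a)"
    using assms by simp
  also have "\<dots> = (G \<triangleright> u) \<cdot> (\<eta> \<triangleleft> a)"
    using interchange[of a "dom1 C a" "cod1 C a" F "cod1 C F" "id2 C a" a u b \<eta> G "id2 C G" G] assms arr
    by (auto simp: lwhisker_def rwhisker_def)
  finally show ?thesis .
qed

lemma in_own_hom_arr:
  assumes "\<alpha> \<in> Arr2 C" "dom1 C (dom2 C \<alpha>) = X" "cod1 C (dom2 C \<alpha>) = Y"
  shows "\<alpha> \<in> hom_arr C X Y"
  using assms dom2_arr[of \<alpha>] cod2_arr[of \<alpha>] parallel_dom[of \<alpha>] parallel_cod[of \<alpha>]
  by (simp add: hom_arr_iff)

lemma rwhisker_comp1: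
  assumes "F \<in> Arr1 C" "G \<in> Arr1 C" "\<alpha> \<in> Arr2 C" "cod1 C F = dom1 C G"
    "cod1 C G = dom1 C (dom2 C \<alpha>)"
  shows "(\<alpha> \<triangleleft> G) \<triangleleft> F = \<alpha> \<triangleleft> (G \<odot> F)"
proof -
  have "(\<alpha> \<star> id2 C G) \<star> id2 C F = \<alpha> \<star> (id2 C G \<star> id2 C F)"
    using assms by (intro hcomp_assoc) (auto intro!: in_own_hom_arr)
  then show ?thesis
    using hcomp_id2[of F "dom1 C F" "dom1 C G" G "cod1 C G"] assms by (simp add: rwhisker_def)
qed

lemma lwhisker_comp1:
  assumes "F \<in> Arr1 C" "G \<in> Arr1 C" "\<alpha> \<in> Arr2 C" "cod1 C (dom2 C \<alpha>) = dom1 C F"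
    "cod1 C F = dom1 C G"
  shows "(G \<odot> F) \<triangleright> \<alpha> = G \<triangleright> (F \<triangleright> \<alpha>)"
proof -
  have "(id2 C G \<star> id2 C F) \<star> \<alpha> = id2 C G \<star> (id2 C F \<star> \<alpha>)"
    using assms by (intro hcomp_assoc) (auto intro!: in_own_hom_arr)
  then show ?thesis
    using hcomp_id2[of F "dom1 C F" "dom1 C G" G "cod1 C G"] assms by (simp add: lwhisker_def)
qed

lemma lwhisker_rwhisker:
  assumes "F \<in> Arr1 C" "G \<in> Arr1 C" "\<alpha> \<in> Arr2 C" "cod1 C F = dom1 C (dom2 C \<alpha>)"
    "cod1 C (dom2 C \<alpha>) = dom1 C G"
  shows "(G \<triangleright> \<alpha>) \<triangleleft> F = G \<triangleright> (\<alpha> \<triangleleft> F)"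
  unfolding lwhisker_def rwhisker_def
  using assms by (intro hcomp_assoc) (auto intro!: in_own_hom_arr)

lemma lwhisker_id1:
  assumes "\<alpha> \<in> Arr2 C" "cod1 C (dom2 C \<alpha>) = X"
  shows "id1 C X \<triangleright> \<alpha> = \<alpha>"
  unfolding lwhisker_def using assms by (intro hcomp_id_left) (auto intro!: in_own_hom_arr)

lemma pushout_factor:
  assumes "is_pushout C X Y f g u w" "T \<in> hom1 C X Y"
    "x \<in> hom2 C (cod2 C f) T" "y \<in> hom2 C (cod2 C g) T" "x \<cdot> f = y \<cdot> g"
  obtains z where "z \<in> hom2 C (cod2 C u) T" "z \<cdot> u = x" "z \<cdot> w = y"
proof -
  have "\<exists>!z. z \<in> hom2 C (cod2 C u) T \<and> z \<cdot> u = x \<and> z \<cdot> w = y"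
    using assms unfolding is_pushout_def by blast
  then show ?thesis using that by blast
qed

lemma pushout_ext:
  assumes P: "is_pushout C X Y f g u w" and T: "T \<in> hom1 C X Y"
    and z: "z \<in> hom2 C (cod2 C u) T" and z': "z' \<in> hom2 C (cod2 C u) T"
    and u: "z \<cdot> u = z' \<cdot> u" and w: "z \<cdot> w = z' \<cdot> w"
  shows "z = z'"
proof -
  have typing: "f \<in> Arr2 C" "g \<in> Arr2 C" "u \<in> Arr2 C" "w \<in> Arr2 C" "dom2 C u = cod2 C f"
    "dom2 C w = cod2 C g" "cod2 C u = cod2 C w" and sq: "u \<cdot> f = w \<cdot> g"
    using P by (auto simp: is_pushout_def hom_arr_iff)
  have "(z \<cdot> u) \<cdot> f = (z \<cdot> w) \<cdot> g"
    using typing sq z by simp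
  moreover have "z \<cdot> u \<in> hom2 C (cod2 C f) T" "z \<cdot> w \<in> hom2 C (cod2 C g) T"
    using typing z by simp_all
  ultimately have "\<exists>!y. y \<in> hom2 C (cod2 C u) T \<and> y \<cdot> u = z \<cdot> u \<and> y \<cdot> w = z \<cdot> w"
    using P T unfolding is_pushout_def by blast
  then show ?thesis using z z' u w by metis
qed

end

section \<open>Lifting against strong deformation retracts\<close>

context formal_setting
begin

text \<open>The homotopy \<open>h H\<close> starts at \<open>h m r = f g r\<close>, which has the lift \<open>g r\<close>; lifting \<open>h H\<close> from there
  and taking the other end gives a lift of \<open>h\<close> itself. The strong condition, that \<open>H\<close> be
  constant along \<open>m\<close>, is what lets normality and naturality of the cleavage keep the lift equal to \<open>g\<close>
  on \<open>b\<close>.\<close>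

lemma fibration_lifts_against_deformation_retract:
  assumes A: "A \<in> Obj C" and cyl: "cylinder C A Cyl i0 i1" and con: "contraction C A Cyl i0 i1 p"
    and f: "f \<in> hom_arr C one A" and fib: "normally_cloven_fibration C one A Cyl i0 p f"
    and b: "b \<in> hom1 C one A" and c: "c \<in> hom1 C one A"
    and m: "m \<in> hom2 C b c" and r: "r \<in> hom2 C c b" and H: "H \<in> hom2 C (Cyl \<odot> c) c"
    and rm: "r \<cdot> m = id2 C b"
    and H0: "H \<cdot> (i0 \<triangleleft> c) = m \<cdot> r" and H1: "H \<cdot> (i1 \<triangleleft> c) = id2 C c"
    and Hm: "H \<cdot> (Cyl \<triangleright> m) = m \<cdot> (p \<triangleleft> b)"
    and g: "g \<in> hom2 C b (dom2 C f)" and h: "h \<in> hom2 C c (cod2 C f)" and fg: "f \<cdot> g = h \<cdot> m"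
  shows "\<exists>l \<in> hom2 C c (dom2 C f). l \<cdot> m = g \<and> f \<cdot> l = h"
proof -
  note typing [simp] = A cyl[unfolded cylinder_def, simplified] con[unfolded contraction_def, simplified]
    f[unfolded hom_arr_iff, simplified] b[simplified] c[simplified] m[simplified] r[simplified]
    H[simplified] g[simplified] h[simplified]
  obtain l where
    lift: "\<forall>a\<in>hom1 C one A. \<forall>g\<in>hom2 C a (dom2 C f). \<forall>h\<in>hom2 C (Cyl \<odot> a) (cod2 C f).
        h \<cdot> (i0 \<triangleleft> a) = f \<cdot> g \<longrightarrow>
        l a g h \<in> hom2 C (Cyl \<odot> a) (dom2 C f) \<and> l a g h \<cdot> (i0 \<triangleleft> a) = g \<and> f \<cdot> l a g h = h"
    and normal: "\<forall>a\<in>hom1 C one A. \<forall>g\<in>hom2 C a (dom2 C f).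
        l a g (f \<cdot> g \<cdot> (p \<triangleleft> a)) = g \<cdot> (p \<triangleleft> a)"
    and natural: "\<forall>a\<in>hom1 C one A. \<forall>g\<in>hom2 C a (dom2 C f). \<forall>h\<in>hom2 C (Cyl \<odot> a) (cod2 C f).
        h \<cdot> (i0 \<triangleleft> a) = f \<cdot> g \<longrightarrow>
        (\<forall>a'\<in>hom1 C one A. \<forall>u\<in>hom2 C a' a.
          l a' (g \<cdot> u) (h \<cdot> (Cyl \<triangleright> u)) = l a g h \<cdot> (Cyl \<triangleright> u))"
    using fib unfolding normally_cloven_fibration_def Let_def by (elim exE conjE)
  define L where "L = l c (g \<cdot> r) (h \<cdot> H)"
  have sq: "(h \<cdot> H) \<cdot> (i0 \<triangleleft> c) = f \<cdot> (g \<cdot> r)"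
  proof -
    have "(h \<cdot> H) \<cdot> (i0 \<triangleleft> c) = (h \<cdot> m) \<cdot> r"
      using H0 by simp
    also have "\<dots> = f \<cdot> (g \<cdot> r)"
      unfolding fg[symmetric] by simp
    finally show ?thesis .
  qed
  have L: "L \<in> hom2 C (Cyl \<odot> c) (dom2 C f)" "f \<cdot> L = h \<cdot> H"
    unfolding L_def using lift[rule_format, OF c _ _ sq] by simp_all
  note [simp] = L(1)[simplified]
  \<comment> \<open>Along \<open>m\<close> the homotopy is constant, so the chosen lift is constant there by the normality of
    the cleavage.\<close>
  have Lm: "L \<cdot> (Cyl \<triangleright> m) = g \<cdot> (p \<triangleleft> b)"
  proof -
    have "L \<cdot> (Cyl \<triangleright> m) = l b ((g \<cdot> r) \<cdot> m) ((h \<cdot> H) \<cdot> (Cyl \<triangleright> m))"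
      unfolding L_def by (rule natural[rule_format, OF c _ _ sq b m, symmetric]) simp_all
    also have "(g \<cdot> r) \<cdot> m = g"
      by (simp add: rm)
    also have "(h \<cdot> H) \<cdot> (Cyl \<triangleright> m) = (h \<cdot> m) \<cdot> (p \<triangleleft> b)"
      by (simp add: Hm)
    also have "\<dots> = f \<cdot> g \<cdot> (p \<triangleleft> b)"
      unfolding fg ..
    also have "l b g \<dots> = g \<cdot> (p \<triangleleft> b)"
      by (rule normal[rule_format]) simp_all
    finally show ?thesis .
  qed
  have "(L \<cdot> (i1 \<triangleleft> c)) \<cdot> m = g"
  proof -
    have "(i1 \<triangleleft> c) \<cdot> (id1 C A \<triangleright> m) = (Cyl \<triangleright> m) \<cdot> (i1 \<triangleleft> b)"
      by (rule whisker_naturality) simp_all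
    then have nat: "(i1 \<triangleleft> c) \<cdot> m = (Cyl \<triangleright> m) \<cdot> (i1 \<triangleleft> b)"
      by (simp add: lwhisker_id1)
    have pi1: "(p \<triangleleft> b) \<cdot> (i1 \<triangleleft> b) = id2 C b"
      using rwhisker_vcomp[of b i1 p] by (simp add: rwhisker_id2)
    have "(L \<cdot> (i1 \<triangleleft> c)) \<cdot> m = (L \<cdot> (Cyl \<triangleright> m)) \<cdot> (i1 \<triangleleft> b)"
      by (simp add: nat)
    also have "\<dots> = g"
      unfolding Lm by (simp add: pi1)
    finally show ?thesis .
  qed
  moreover have "f \<cdot> (L \<cdot> (i1 \<triangleleft> c)) = h"
  proof -
    have "f \<cdot> (L \<cdot> (i1 \<triangleleft> c)) = (f \<cdot> L) \<cdot> (i1 \<triangleleft> c)"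
      by simp
    also have "\<dots> = h"
      unfolding L(2) by (simp add: H1)
    finally show ?thesis .
  qed
  ultimately show ?thesis
    by (intro bexI[of _ "L \<cdot> (i1 \<triangleleft> c)"]) simp_all
qed

end

section \<open>The deformation of the cylinder onto the mapping cylinder\<close>

locale structured_cylinder = formal_setting C one
  for C :: "('o, 'm, 'c) two_category" (structure) and one :: 'o +
  fixes A :: 'o and Cyl S :: 'm and i0 i1 p v r0 r1 s \<Gamma>lr \<Gamma>ur :: 'c
  assumes A_obj: "A \<in> Obj C"
    and cyl: "cylinder C A Cyl i0 i1"
    and con: "contraction C A Cyl i0 i1 p"
    and inv: "involution C Cyl i0 i1 v"
    and sub: "subdivision C A Cyl i0 i1 S r0 r1 s"
    and sub_con: "subdivision_compatible_contraction C A p S r0 r1 s"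
    and lr: "lower_right_connection C Cyl i0 i1 p \<Gamma>lr"
    and ur: "upper_right_connection C Cyl i0 i1 p v \<Gamma>ur"
    and conn_sub: "connections_compatible_subdivision C Cyl p S r0 r1 s \<Gamma>lr \<Gamma>ur"
begin

lemma structure_typing [simp]:
  "A \<in> Obj C"
  "Cyl \<in> Arr1 C" "dom1 C Cyl = A" "cod1 C Cyl = A"
  "S \<in> Arr1 C" "dom1 C S = A" "cod1 C S = A"
  "i0 \<in> Arr2 C" "dom2 C i0 = id1 C A" "cod2 C i0 = Cyl"
  "i1 \<in> Arr2 C" "dom2 C i1 = id1 C A" "cod2 C i1 = Cyl"
  "p \<in> Arr2 C" "dom2 C p = Cyl" "cod2 C p = id1 C A"
  "r0 \<in> Arr2 C" "dom2 C r0 = Cyl" "cod2 C r0 = S"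
  "r1 \<in> Arr2 C" "dom2 C r1 = Cyl" "cod2 C r1 = S"
  "s \<in> Arr2 C" "dom2 C s = Cyl" "cod2 C s = S"
  "\<Gamma>lr \<in> Arr2 C" "dom2 C \<Gamma>lr = Cyl \<odot> Cyl" "cod2 C \<Gamma>lr = Cyl"
  "\<Gamma>ur \<in> Arr2 C" "dom2 C \<Gamma>ur = Cyl \<odot> Cyl" "cod2 C \<Gamma>ur = Cyl"
  using A_obj cyl con sub lr ur
  by (simp_all add: cylinder_def contraction_def subdivision_def lower_right_connection_def
      upper_right_connection_def)

context
  fixes a :: 'm
  assumes a: "a \<in> hom1 C one A"
begin

text \<open>The equations between 2-arrows are evaluated at an object of \<open>A\<close>, so that the remaining argument
  takes place in the category of objects and arrows of \<open>A\<close>. For the subdivision, this is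
  where evaluation has to preserve pushouts.\<close>

lemma subdivision_at:
  "is_pushout C one A (i0 \<triangleleft> a) (i1 \<triangleleft> a) (r0 \<triangleleft> a) (r1 \<triangleleft> a)"
  using sub a by (intro eval_pushout[of A A]) (simp_all add: subdivision_def)

lemma subdivision_ends_at:
  "(s \<triangleleft> a) \<cdot> (i0 \<triangleleft> a) = (r1 \<triangleleft> a) \<cdot> (i0 \<triangleleft> a)"
  "(s \<triangleleft> a) \<cdot> (i1 \<triangleleft> a) = (r0 \<triangleleft> a) \<cdot> (i1 \<triangleleft> a)"
  using sub a by (simp_all add: subdivision_def flip: rwhisker_vcomp)

lemma lower_right_connection_at:
  "(\<Gamma>lr \<triangleleft> a) \<cdot> (i0 \<triangleleft> (Cyl \<odot> a)) = (i0 \<triangleleft> a) \<cdot> (p \<triangleleft> a)"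
  "(\<Gamma>lr \<triangleleft> a) \<cdot> (i1 \<triangleleft> (Cyl \<odot> a)) = id2 C (Cyl \<odot> a)"
  "(\<Gamma>lr \<triangleleft> a) \<cdot> (Cyl \<triangleright> (i0 \<triangleleft> a)) = (i0 \<triangleleft> a) \<cdot> (p \<triangleleft> a)"
proof -
  have e: "\<Gamma>lr \<cdot> (i0 \<triangleleft> Cyl) = i0 \<cdot> p" "\<Gamma>lr \<cdot> (i1 \<triangleleft> Cyl) = id2 C Cyl"
    "\<Gamma>lr \<cdot> (Cyl \<triangleright> i0) = i0 \<cdot> p"
    using lr by (simp_all add: lower_right_connection_def)
  show "(\<Gamma>lr \<triangleleft> a) \<cdot> (i0 \<triangleleft> (Cyl \<odot> a)) = (i0 \<triangleleft> a) \<cdot> (p \<triangleleft> a)"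
    using arg_cong[OF e(1), of "\<lambda>\<alpha>. \<alpha> \<triangleleft> a"] a by (simp add: rwhisker_vcomp rwhisker_comp1)
  show "(\<Gamma>lr \<triangleleft> a) \<cdot> (i1 \<triangleleft> (Cyl \<odot> a)) = id2 C (Cyl \<odot> a)"
    using arg_cong[OF e(2), of "\<lambda>\<alpha>. \<alpha> \<triangleleft> a"] a
    by (simp add: rwhisker_vcomp rwhisker_comp1 rwhisker_id2)
  show "(\<Gamma>lr \<triangleleft> a) \<cdot> (Cyl \<triangleright> (i0 \<triangleleft> a)) = (i0 \<triangleleft> a) \<cdot> (p \<triangleleft> a)"
    using arg_cong[OF e(3), of "\<lambda>\<alpha>. \<alpha> \<triangleleft> a"] a by (simp add: rwhisker_vcomp lwhisker_rwhisker)
qed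

lemma upper_right_connection_at:
  "(\<Gamma>ur \<triangleleft> a) \<cdot> (i0 \<triangleleft> (Cyl \<odot> a)) = id2 C (Cyl \<odot> a)"
  "(\<Gamma>ur \<triangleleft> a) \<cdot> (i1 \<triangleleft> (Cyl \<odot> a)) = (i0 \<triangleleft> a) \<cdot> (p \<triangleleft> a)"
  "(\<Gamma>ur \<triangleleft> a) \<cdot> (Cyl \<triangleright> (i0 \<triangleleft> a)) = (i0 \<triangleleft> a) \<cdot> (p \<triangleleft> a)"
proof -
  have e: "\<Gamma>ur \<cdot> (i0 \<triangleleft> Cyl) = id2 C Cyl" "\<Gamma>ur \<cdot> (i1 \<triangleleft> Cyl) = i0 \<cdot> p"
    "\<Gamma>ur \<cdot> (Cyl \<triangleright> i0) = i0 \<cdot> p"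
    using ur by (simp_all add: upper_right_connection_def)
  show "(\<Gamma>ur \<triangleleft> a) \<cdot> (i0 \<triangleleft> (Cyl \<odot> a)) = id2 C (Cyl \<odot> a)"
    using arg_cong[OF e(1), of "\<lambda>\<alpha>. \<alpha> \<triangleleft> a"] a
    by (simp add: rwhisker_vcomp rwhisker_comp1 rwhisker_id2)
  show "(\<Gamma>ur \<triangleleft> a) \<cdot> (i1 \<triangleleft> (Cyl \<odot> a)) = (i0 \<triangleleft> a) \<cdot> (p \<triangleleft> a)"
    using arg_cong[OF e(2), of "\<lambda>\<alpha>. \<alpha> \<triangleleft> a"] a by (simp add: rwhisker_vcomp rwhisker_comp1)
  show "(\<Gamma>ur \<triangleleft> a) \<cdot> (Cyl \<triangleright> (i0 \<triangleleft> a)) = (i0 \<triangleleft> a) \<cdot> (p \<triangleleft> a)"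
    using arg_cong[OF e(3), of "\<lambda>\<alpha>. \<alpha> \<triangleleft> a"] a by (simp add: rwhisker_vcomp lwhisker_rwhisker)
qed

lemma subdivision_contraction_at:
  obtains q where "q \<in> hom2 C (S \<odot> a) a" "q \<cdot> (r0 \<triangleleft> a) = p \<triangleleft> a" "q \<cdot> (r1 \<triangleleft> a) = p \<triangleleft> a"
    "q \<cdot> (s \<triangleleft> a) = p \<triangleleft> a"
proof -
  let ?P = "\<lambda>q. q \<in> hom2 C S (id1 C A) \<and> q \<cdot> r0 = p \<and> q \<cdot> r1 = p"
  have P: "is_pushout C A A i0 i1 r0 r1"
    using sub by (simp add: subdivision_def)
  have "p \<cdot> i0 = p \<cdot> i1"
    using con by (simp add: contraction_def)
  with P have "\<exists>!q. ?P q"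
    unfolding is_pushout_def by fastforce
  from theI'[OF this] obtain q where "?P q" "q \<cdot> s = p"
    using sub_con
    unfolding subdivision_compatible_contraction_def subdivision_contraction_def by blast
  with a show ?thesis
    by (intro that[of "q \<triangleleft> a"]) (simp_all flip: rwhisker_vcomp)
qed

lemma connections_compatible_at:
  obtains x where "x \<in> hom2 C (S \<odot> (Cyl \<odot> a)) (Cyl \<odot> a)"
    "x \<cdot> (r0 \<triangleleft> (Cyl \<odot> a)) = \<Gamma>lr \<triangleleft> a" "x \<cdot> (r1 \<triangleleft> (Cyl \<odot> a)) = \<Gamma>ur \<triangleleft> a"
    "x \<cdot> (s \<triangleleft> (Cyl \<odot> a)) = p \<triangleleft> (Cyl \<odot> a)"
proof -
  obtain x where x [simp]: "x \<in> Arr2 C" "dom2 C x = S \<odot> Cyl" "cod2 C x = Cyl"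
    and e: "x \<cdot> (r0 \<triangleleft> Cyl) = \<Gamma>lr" "x \<cdot> (r1 \<triangleleft> Cyl) = \<Gamma>ur" "x \<cdot> (s \<triangleleft> Cyl) = p \<triangleleft> Cyl"
    using conn_sub unfolding connections_compatible_subdivision_def Let_def by auto
  show ?thesis
  proof (rule that[of "x \<triangleleft> a"])
    show "(x \<triangleleft> a) \<cdot> (r0 \<triangleleft> (Cyl \<odot> a)) = \<Gamma>lr \<triangleleft> a"
      using arg_cong[OF e(1), of "\<lambda>\<alpha>. \<alpha> \<triangleleft> a"] a by (simp add: rwhisker_vcomp rwhisker_comp1)
    show "(x \<triangleleft> a) \<cdot> (r1 \<triangleleft> (Cyl \<odot> a)) = \<Gamma>ur \<triangleleft> a"
      using arg_cong[OF e(2), of "\<lambda>\<alpha>. \<alpha> \<triangleleft> a"] a by (simp add: rwhisker_vcomp rwhisker_comp1)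
    show "(x \<triangleleft> a) \<cdot> (s \<triangleleft> (Cyl \<odot> a)) = p \<triangleleft> (Cyl \<odot> a)"
      using arg_cong[OF e(3), of "\<lambda>\<alpha>. \<alpha> \<triangleleft> a"] a by (simp add: rwhisker_vcomp rwhisker_comp1)
  qed (use a in simp)
qed

end

text \<open>The homotopy is \<open>H = K s\<close>, where \<open>K\<close> is \<open>m r \<Gamma>\<^sub>u\<^sub>r\<close> on the half \<open>r\<^sub>1\<close> and \<open>\<Gamma>\<^sub>l\<^sub>r\<close> on the half \<open>r\<^sub>0\<close> of the
  subdivision. The halves are in this order because \<open>s i\<^sub>0 = r\<^sub>1 i\<^sub>0\<close>: the path \<open>s\<close> runs through \<open>r\<^sub>1\<close>
  before \<open>r\<^sub>0\<close>. They agree in the middle because \<open>m r\<close> fixes \<open>i\<^sub>0\<close>.\<close>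

lemma mapping_cylinder_deformation_retract:
  assumes pres: "preserves_mapping_cylinders C one A Cyl i0"
    and j: "j \<in> hom2 C a0 a1" and a0: "a0 \<in> hom1 C one A" and a1: "a1 \<in> hom1 C one A"
    and mc: "mapping_cylinder C one A Cyl i0 j aj d0 d1"
    and m: "m \<in> hom2 C aj (Cyl \<odot> a1)" and m0: "m \<cdot> d0 = Cyl \<triangleright> j" and m1: "m \<cdot> d1 = i0 \<triangleleft> a1"
    and r: "r \<in> hom2 C (Cyl \<odot> a1) aj" and r_d0: "r \<cdot> (Cyl \<triangleright> j) = d0"
    and r_d1: "r \<cdot> (i0 \<triangleleft> a1) = d1"
  obtains H where "H \<in> hom2 C (Cyl \<odot> (Cyl \<odot> a1)) (Cyl \<odot> a1)"
    "H \<cdot> (i0 \<triangleleft> (Cyl \<odot> a1)) = m \<cdot> r" "H \<cdot> (i1 \<triangleleft> (Cyl \<odot> a1)) = id2 C (Cyl \<odot> a1)"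
    "H \<cdot> (Cyl \<triangleright> m) = m \<cdot> (p \<triangleleft> aj)"
proof -
  note typing [simp] = j[simplified] a0[simplified] a1[simplified] m[simplified] r[simplified]
  have mc_typing [simp]: "aj \<in> Arr1 C" "dom1 C aj = one" "cod1 C aj = A"
    "d0 \<in> Arr2 C" "dom2 C d0 = Cyl \<odot> a0" "cod2 C d0 = aj"
    "d1 \<in> Arr2 C" "dom2 C d1 = a1" "cod2 C d1 = aj"
    using mc by (simp_all add: mapping_cylinder_def)
  have mr_j: "m \<cdot> (r \<cdot> (Cyl \<triangleright> j)) = Cyl \<triangleright> j" and mr_i0: "m \<cdot> (r \<cdot> (i0 \<triangleleft> a1)) = i0 \<triangleleft> a1"
    by (simp_all add: r_d0 r_d1 m0 m1)
  have ca1: "Cyl \<odot> a1 \<in> hom1 C one A" and ca0: "Cyl \<odot> a0 \<in> hom1 C one A"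
    by simp_all
  have mr_i0_p: "m \<cdot> (r \<cdot> ((i0 \<triangleleft> a1) \<cdot> (p \<triangleleft> a1))) = (i0 \<triangleleft> a1) \<cdot> (p \<triangleleft> a1)"
    using arg_cong[OF mr_i0, of "\<lambda>\<alpha>. \<alpha> \<cdot> (p \<triangleleft> a1)"] by simp
  \<comment> \<open>Contract \<open>m r\<close> to \<open>i\<^sub>0 p\<close>, then expand \<open>i\<^sub>0 p\<close> to the identity.\<close>
  obtain K where K: "K \<in> hom2 C (S \<odot> (Cyl \<odot> a1)) (Cyl \<odot> a1)"
    and Kr0: "K \<cdot> (r0 \<triangleleft> (Cyl \<odot> a1)) = \<Gamma>lr \<triangleleft> a1"
    and Kr1: "K \<cdot> (r1 \<triangleleft> (Cyl \<odot> a1)) = m \<cdot> (r \<cdot> (\<Gamma>ur \<triangleleft> a1))"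
  proof (rule pushout_factor[OF subdivision_at[OF ca1] ca1])
    show "(\<Gamma>lr \<triangleleft> a1) \<cdot> (i0 \<triangleleft> (Cyl \<odot> a1)) = (m \<cdot> (r \<cdot> (\<Gamma>ur \<triangleleft> a1))) \<cdot> (i1 \<triangleleft> (Cyl \<odot> a1))"
      by (simp add: lower_right_connection_at[OF a1] upper_right_connection_at[OF a1] mr_i0_p)
  qed (auto)
  note [simp] = K[simplified]
  define H where "H = K \<cdot> (s \<triangleleft> (Cyl \<odot> a1))"
  have H: "H \<in> hom2 C (Cyl \<odot> (Cyl \<odot> a1)) (Cyl \<odot> a1)"
    by (simp add: H_def)
  note [simp] = H[simplified]
  have H0: "H \<cdot> (i0 \<triangleleft> (Cyl \<odot> a1)) = m \<cdot> r"
  proof -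
    have "H \<cdot> (i0 \<triangleleft> (Cyl \<odot> a1)) = (K \<cdot> (r1 \<triangleleft> (Cyl \<odot> a1))) \<cdot> (i0 \<triangleleft> (Cyl \<odot> a1))"
      by (simp add: H_def subdivision_ends_at[OF ca1])
    also have "\<dots> = m \<cdot> r"
      unfolding Kr1 by (simp add: upper_right_connection_at[OF a1])
    finally show ?thesis .
  qed
  have H1: "H \<cdot> (i1 \<triangleleft> (Cyl \<odot> a1)) = id2 C (Cyl \<odot> a1)"
  proof -
    have "H \<cdot> (i1 \<triangleleft> (Cyl \<odot> a1)) = (K \<cdot> (r0 \<triangleleft> (Cyl \<odot> a1))) \<cdot> (i1 \<triangleleft> (Cyl \<odot> a1))"
      by (simp add: H_def subdivision_ends_at[OF ca1])
    also have "\<dots> = id2 C (Cyl \<odot> a1)"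
      unfolding Kr0 by (simp add: lower_right_connection_at[OF a1])
    finally show ?thesis .
  qed
  have nat_at: "(\<eta> \<triangleleft> (Cyl \<odot> a1)) \<cdot> (Cyl \<triangleright> u) = (S \<triangleright> u) \<cdot> (\<eta> \<triangleleft> b)"
    if "\<eta> \<in> hom2 C Cyl S" "u \<in> hom2 C b (Cyl \<odot> a1)" "b \<in> hom1 C one A" for \<eta> u b
    using that by (intro whisker_naturality) simp_all
  have K_S: "(K \<cdot> (S \<triangleright> u)) \<cdot> (\<eta> \<triangleleft> b) = (K \<cdot> (\<eta> \<triangleleft> (Cyl \<odot> a1))) \<cdot> (Cyl \<triangleright> u)"
    if "\<eta> \<in> hom2 C Cyl S" "u \<in> hom2 C b (Cyl \<odot> a1)" "b \<in> hom1 C one A" for \<eta> u b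
    using that nat_at[OF that] by simp
  \<comment> \<open>On the end \<open>i\<^sub>0\<close> both halves of \<open>K\<close> are the constant homotopy \<open>i\<^sub>0 p\<close>, so that \<open>K\<close> factors through
    the contraction of the subdivision.\<close>
  have H_on_d1: "H \<cdot> (Cyl \<triangleright> (i0 \<triangleleft> a1)) = (i0 \<triangleleft> a1) \<cdot> (p \<triangleleft> a1)"
  proof -
    obtain q where q: "q \<in> hom2 C (S \<odot> a1) a1" "q \<cdot> (r0 \<triangleleft> a1) = p \<triangleleft> a1"
      "q \<cdot> (r1 \<triangleleft> a1) = p \<triangleleft> a1" "q \<cdot> (s \<triangleleft> a1) = p \<triangleleft> a1"
      by (rule subdivision_contraction_at[OF a1])
    note [simp] = q(1)[simplified]
    have i0: "i0 \<triangleleft> a1 \<in> hom2 C a1 (Cyl \<odot> a1)"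
      by simp
    have "K \<cdot> (S \<triangleright> (i0 \<triangleleft> a1)) = (i0 \<triangleleft> a1) \<cdot> q"
    proof (rule pushout_ext[OF subdivision_at[OF a1] ca1])
      show "(K \<cdot> (S \<triangleright> (i0 \<triangleleft> a1))) \<cdot> (r0 \<triangleleft> a1) = ((i0 \<triangleleft> a1) \<cdot> q) \<cdot> (r0 \<triangleleft> a1)"
        by (subst K_S[OF _ i0 a1]) (simp_all only: Kr0, simp_all add: lower_right_connection_at[OF a1] q)
      show "(K \<cdot> (S \<triangleright> (i0 \<triangleleft> a1))) \<cdot> (r1 \<triangleleft> a1) = ((i0 \<triangleleft> a1) \<cdot> q) \<cdot> (r1 \<triangleleft> a1)"
        by (subst K_S[OF _ i0 a1])
          (simp_all only: Kr1, simp_all add: upper_right_connection_at[OF a1] q mr_i0_p)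
    qed simp_all
    then have "(K \<cdot> (S \<triangleright> (i0 \<triangleleft> a1))) \<cdot> (s \<triangleleft> a1) = (i0 \<triangleleft> a1) \<cdot> (p \<triangleleft> a1)"
      by (simp add: q)
    then show ?thesis
      unfolding H_def by (subst (asm) K_S[OF _ i0 a1]) simp_all
  qed
  \<comment> \<open>By naturality of the connections and \<open>m r Cyl(j) = Cyl(j)\<close>, over \<open>Cyl(a\<^sub>0)\<close> the two halves of \<open>K\<close> are
    \<open>\<Gamma>\<^sub>l\<^sub>r\<close> and \<open>\<Gamma>\<^sub>u\<^sub>r\<close> followed by \<open>Cyl(j)\<close>, so that \<open>K\<close> is the canonical arrow \<open>x\<close> followed by \<open>Cyl(j)\<close>.\<close>
  have H_on_d0: "H \<cdot> (Cyl \<triangleright> (Cyl \<triangleright> j)) = (Cyl \<triangleright> j) \<cdot> (p \<triangleleft> (Cyl \<odot> a0))"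
  proof -
    obtain x where x: "x \<in> hom2 C (S \<odot> (Cyl \<odot> a0)) (Cyl \<odot> a0)"
      "x \<cdot> (r0 \<triangleleft> (Cyl \<odot> a0)) = \<Gamma>lr \<triangleleft> a0" "x \<cdot> (r1 \<triangleleft> (Cyl \<odot> a0)) = \<Gamma>ur \<triangleleft> a0"
      "x \<cdot> (s \<triangleleft> (Cyl \<odot> a0)) = p \<triangleleft> (Cyl \<odot> a0)"
      by (rule connections_compatible_at[OF a0])
    note [simp] = x(1)[simplified]
    have cj: "Cyl \<triangleright> j \<in> hom2 C (Cyl \<odot> a0) (Cyl \<odot> a1)"
      by simp
    have \<Gamma>_nat: "(\<Gamma> \<triangleleft> a1) \<cdot> (Cyl \<triangleright> (Cyl \<triangleright> j)) = (Cyl \<triangleright> j) \<cdot> (\<Gamma> \<triangleleft> a0)"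
      if "\<Gamma> \<in> hom2 C (Cyl \<odot> Cyl) Cyl" for \<Gamma>
      using whisker_naturality[OF that j] by (simp add: lwhisker_comp1)
    have mr_\<Gamma>ur: "m \<cdot> (r \<cdot> ((Cyl \<triangleright> j) \<cdot> (\<Gamma>ur \<triangleleft> a0))) = (Cyl \<triangleright> j) \<cdot> (\<Gamma>ur \<triangleleft> a0)"
      using arg_cong[OF mr_j, of "\<lambda>\<alpha>. \<alpha> \<cdot> (\<Gamma>ur \<triangleleft> a0)"] by simp
    have "K \<cdot> (S \<triangleright> (Cyl \<triangleright> j)) = (Cyl \<triangleright> j) \<cdot> x"
    proof (rule pushout_ext[OF subdivision_at[OF ca0] ca1])
      show "(K \<cdot> (S \<triangleright> (Cyl \<triangleright> j))) \<cdot> (r0 \<triangleleft> (Cyl \<odot> a0)) = ((Cyl \<triangleright> j) \<cdot> x) \<cdot> (r0 \<triangleleft> (Cyl \<odot> a0))"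
        by (subst K_S[OF _ cj ca0]) (simp_all only: Kr0, simp_all add: \<Gamma>_nat x)
      show "(K \<cdot> (S \<triangleright> (Cyl \<triangleright> j))) \<cdot> (r1 \<triangleleft> (Cyl \<odot> a0)) = ((Cyl \<triangleright> j) \<cdot> x) \<cdot> (r1 \<triangleleft> (Cyl \<odot> a0))"
        by (subst K_S[OF _ cj ca0]) (simp_all only: Kr1, simp_all add: \<Gamma>_nat mr_\<Gamma>ur x)
    qed simp_all
    then have "(K \<cdot> (S \<triangleright> (Cyl \<triangleright> j))) \<cdot> (s \<triangleleft> (Cyl \<odot> a0)) = (Cyl \<triangleright> j) \<cdot> (p \<triangleleft> (Cyl \<odot> a0))"
      by (simp add: x)
    then show ?thesis
      unfolding H_def by (subst (asm) K_S[OF _ cj ca0]) simp_all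
  qed
  have p_nat: "(p \<triangleleft> aj) \<cdot> (Cyl \<triangleright> u) = u \<cdot> (p \<triangleleft> b)"
    if "u \<in> hom2 C b aj" "b \<in> hom1 C one A" for u b
    using whisker_naturality[of p Cyl "id1 C A" u b aj] that by (simp add: lwhisker_id1)
  \<comment> \<open>The two computations determine \<open>H\<close> on all of \<open>Cyl(a\<^sub>j)\<close>, since \<open>Cyl\<close> preserves the pushout \<open>a\<^sub>j\<close>.\<close>
  have "H \<cdot> (Cyl \<triangleright> m) = m \<cdot> (p \<triangleleft> aj)"
  proof (rule pushout_ext[OF _ ca1])
    have "j \<in> hom_arr C one A"
      by (simp add: hom_arr_iff)
    then show "is_pushout C one A (Cyl \<triangleright> (i0 \<triangleleft> a0)) (Cyl \<triangleright> j) (Cyl \<triangleright> d0) (Cyl \<triangleright> d1)"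
      using pres mc unfolding preserves_mapping_cylinders_def by fastforce
    have "(H \<cdot> (Cyl \<triangleright> m)) \<cdot> (Cyl \<triangleright> d0) = H \<cdot> (Cyl \<triangleright> (Cyl \<triangleright> j))"
      by (simp add: m0 flip: lwhisker_vcomp)
    also have "\<dots> = (m \<cdot> d0) \<cdot> (p \<triangleleft> (Cyl \<odot> a0))"
      unfolding H_on_d0 m0 ..
    also have "\<dots> = (m \<cdot> (p \<triangleleft> aj)) \<cdot> (Cyl \<triangleright> d0)"
      by (simp add: p_nat)
    finally show "(H \<cdot> (Cyl \<triangleright> m)) \<cdot> (Cyl \<triangleright> d0) = (m \<cdot> (p \<triangleleft> aj)) \<cdot> (Cyl \<triangleright> d0)" .
    have "(H \<cdot> (Cyl \<triangleright> m)) \<cdot> (Cyl \<triangleright> d1) = H \<cdot> (Cyl \<triangleright> (i0 \<triangleleft> a1))"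
      by (simp add: m1 flip: lwhisker_vcomp)
    also have "\<dots> = (m \<cdot> d1) \<cdot> (p \<triangleleft> a1)"
      unfolding H_on_d1 m1 ..
    also have "\<dots> = (m \<cdot> (p \<triangleleft> aj)) \<cdot> (Cyl \<triangleright> d1)"
      by (simp add: p_nat)
    finally show "(H \<cdot> (Cyl \<triangleright> m)) \<cdot> (Cyl \<triangleright> d1) = (m \<cdot> (p \<triangleleft> aj)) \<cdot> (Cyl \<triangleright> d1)" .
  qed simp_all
  with H H0 H1 show ?thesis
    by (rule that)
qed

lemma mapping_cylinder_map_props:
  assumes j: "j \<in> hom_arr C one A" and mc: "mapping_cylinder C one A Cyl i0 j aj d0 d1"
  defines "m \<equiv> mapping_cylinder_map C Cyl i0 j aj d0 d1"
  shows "m \<in> hom2 C aj (Cyl \<odot> cod2 C j)" "m \<cdot> d0 = Cyl \<triangleright> j" "m \<cdot> d1 = i0 \<triangleleft> cod2 C j"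
proof -
  note [simp] = j[unfolded hom_arr_iff, simplified]
  have nat: "(Cyl \<triangleright> j) \<cdot> (i0 \<triangleleft> dom2 C j) = (i0 \<triangleleft> cod2 C j) \<cdot> j"
    using whisker_naturality[of i0 "id1 C A" Cyl j "dom2 C j" "cod2 C j"] by (simp add: lwhisker_id1)
  have d: "cod2 C d0 = aj" and P: "is_pushout C one A (i0 \<triangleleft> dom2 C j) j d0 d1"
    using mc by (simp_all add: mapping_cylinder_def)
  have "Cyl \<odot> cod2 C j \<in> hom1 C one A" "Cyl \<triangleright> j \<in> hom2 C (cod2 C (i0 \<triangleleft> dom2 C j)) (Cyl \<odot> cod2 C j)"
    "i0 \<triangleleft> cod2 C j \<in> hom2 C (cod2 C j) (Cyl \<odot> cod2 C j)"
    by simp_all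
  with P nat d have "\<exists>!m. m \<in> hom2 C aj (Cyl \<odot> cod2 C j) \<and> m \<cdot> d0 = Cyl \<triangleright> j \<and> m \<cdot> d1 = i0 \<triangleleft> cod2 C j"
    unfolding is_pushout_def by blast
  from theI'[OF this]
  show "m \<in> hom2 C aj (Cyl \<odot> cod2 C j)" "m \<cdot> d0 = Cyl \<triangleright> j" "m \<cdot> d1 = i0 \<triangleleft> cod2 C j"
    unfolding m_def mapping_cylinder_map_def by blast+
qed

section \<open>The covering homotopy extension property\<close>

lemma covering_homotopy_extension:
  assumes pres: "preserves_mapping_cylinders C one A Cyl i0"
    and f: "f \<in> hom_arr C one A" and fib: "normally_cloven_fibration C one A Cyl i0 p f"
    and j_arr: "j \<in> hom_arr C one A" and cof: "cofibration C one A Cyl i0 j"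
    and mc: "mapping_cylinder C one A Cyl i0 j aj d0 d1"
  shows "covering_homotopy_extension_property C Cyl i0 j aj d0 d1 f"
proof -
  define a0 a1 where "a0 = dom2 C j" and "a1 = cod2 C j"
  define m where "m = mapping_cylinder_map C Cyl i0 j aj d0 d1"
  have j: "j \<in> hom2 C a0 a1" and a0: "a0 \<in> hom1 C one A" and a1: "a1 \<in> hom1 C one A"
    using j_arr by (simp_all add: hom_arr_iff a0_def a1_def)
  note [simp] = j[simplified] a0[simplified] a1[simplified]
  have P: "is_pushout C one A (i0 \<triangleleft> a0) j d0 d1" and aj: "aj \<in> hom1 C one A"
    and d: "d0 \<in> hom2 C (Cyl \<odot> a0) aj" "d1 \<in> hom2 C a1 aj"
    using mc by (simp_all add: mapping_cylinder_def)
  note [simp] = aj[simplified] d[simplified]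
  have m: "m \<in> hom2 C aj (Cyl \<odot> a1)" and m0: "m \<cdot> d0 = Cyl \<triangleright> j" and m1: "m \<cdot> d1 = i0 \<triangleleft> a1"
    using mapping_cylinder_map_props[OF j_arr mc] by (simp_all add: m_def)
  note [simp] = m[simplified]
  have "d0 \<cdot> (i0 \<triangleleft> a0) = d1 \<cdot> j"
    using P by (simp add: is_pushout_def)
  \<comment> \<open>The structure arrows of the mapping cylinder are themselves an extension problem for \<open>j\<close>; its
    solution retracts \<open>Cyl(a\<^sub>1)\<close> onto \<open>a\<^sub>j\<close>.\<close>
  then obtain r where r: "r \<in> hom2 C (Cyl \<odot> a1) aj"
    and r_j: "r \<cdot> (Cyl \<triangleright> j) = d0" and r_i0: "r \<cdot> (i0 \<triangleleft> a1) = d1"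
    using cof d aj unfolding cofibration_def Let_def by fastforce
  note [simp] = r[simplified]
  have rm: "r \<cdot> m = id2 C aj"
    by (rule pushout_ext[OF P aj]) (simp_all add: m0 m1 r_j r_i0)
  obtain H where H: "H \<in> hom2 C (Cyl \<odot> (Cyl \<odot> a1)) (Cyl \<odot> a1)"
    "H \<cdot> (i0 \<triangleleft> (Cyl \<odot> a1)) = m \<cdot> r" "H \<cdot> (i1 \<triangleleft> (Cyl \<odot> a1)) = id2 C (Cyl \<odot> a1)"
    "H \<cdot> (Cyl \<triangleright> m) = m \<cdot> (p \<triangleleft> aj)"
    by (rule mapping_cylinder_deformation_retract[OF pres j a0 a1 mc m m0 m1 r
        r_j r_i0])
  have ca1: "Cyl \<odot> a1 \<in> hom1 C one A"
    by simp
  have "\<exists>l \<in> hom2 C (Cyl \<odot> a1) (dom2 C f). l \<cdot> m = g \<and> f \<cdot> l = h"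
    if "g \<in> hom2 C aj (dom2 C f)" "h \<in> hom2 C (Cyl \<odot> a1) (cod2 C f)" "f \<cdot> g = h \<cdot> m" for g h
    by (rule fibration_lifts_against_deformation_retract[OF A_obj cyl con f fib aj ca1
          m r H(1) rm H(2-4) that])
  then show ?thesis
    unfolding covering_homotopy_extension_property_def Let_def a1_def m_def by blast
qed

end

theorem mainTheorem14:
  fixes C :: "('o, 'm, 'c) two_category" and one A :: 'o
    and Cyl S :: 'm and i0 i1 p v r0 r1 s \<Gamma>lr \<Gamma>ur :: 'c
    and f j :: 'c and aj :: 'm and d0 d1 :: 'c
  assumes "formal_setting C one"
    and "A \<in> Obj C"
    and "cylinder C A Cyl i0 i1"
    and "contraction C A Cyl i0 i1 p"
    and "involution C Cyl i0 i1 v"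
    and "subdivision C A Cyl i0 i1 S r0 r1 s"
    and "subdivision_compatible_contraction C A p S r0 r1 s"
    and "lower_right_connection C Cyl i0 i1 p \<Gamma>lr"
    and "upper_right_connection C Cyl i0 i1 p v \<Gamma>ur"
    and "connections_compatible_subdivision C Cyl p S r0 r1 s \<Gamma>lr \<Gamma>ur"
    and "preserves_mapping_cylinders C one A Cyl i0"
    and "f \<in> hom_arr C one A"
    and "normally_cloven_fibration C one A Cyl i0 p f"
    and "j \<in> hom_arr C one A"
    and "cofibration C one A Cyl i0 j"
    and "mapping_cylinder C one A Cyl i0 j aj d0 d1"
  shows "covering_homotopy_extension_property C Cyl i0 j aj d0 d1 f"
proof -
  interpret structured_cylinder C one A Cyl S i0 i1 p v r0 r1 s \<Gamma>lr \<Gamma>ur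
    using assms by (intro structured_cylinder.intro structured_cylinder_axioms.intro)
  show ?thesis
    using assms(11-16) by (rule covering_homotopy_extension)
qed

end
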